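(* Let $a,b$ be positive integers with $b>7a$. Then the gap vector of $\mathcal{Q}_{a,b}$ satisfies $$\gamma(\mathcal{Q}_{a,b})_{i+2}=\binom{i+2}{2}\bigl(\max\{4a-i,0\}+\max\{7a-i,0\}\bigr)\quad\text{for all } i\ge 0.$$
   Context: For a pair $\{i,j\}\subset\{1,2,3,4\}$, $i\ne j$, let $V(i,j)\in\mathbb{Z}^4$ be the vector with coordinates $i$ and $j$ equal to $1$ and the other two equal to $0$. The polytope $\mathcal{Q}_{a,b}$ is the convex hull in $\mathbb{Z}^4\times\mathbb{Z}$ (tensored with the reals) of the twelve points $(V(1,2),0),\ (V(1,2),1)$; $(V(2,3),0),\ (V(2,3),1)$; $(V(1,3),0),\ (V(1,3),1)$; $(V(4,1),0),\ (V(4,1),b)$; $(V(4,2),b+4a+2),\ (V(4,2),2b+4a+2)$; $(V(4,3),2b+11a+4),\ (V(4,3),3b+11a+4)$. For a lattice polytope $\mathcal{P}$ in a lattice $M$ (here $M=\mathbb{Z}^4\times\mathbb{Z}$), let $\mathcal{C}\subset\mathbb{Z}\times M$ be the semigroup of lattice points in the real cone over $\{1\}\times\mathcal{P}$, with coordinate number $0$ being the first one. $Ehr_{\mathcal{P}}(j)$ is the number of points of $\mathcal{C}$ with zeroth coordinate $j$ (that is, the number of lattice points in $j\mathcal{P}$), and $H_{\mathcal{P}}(j)$ is the number of points with zeroth coordinate $j$ in the semigroup generated by the lattice points of $\{1\}\times\mathcal{P}$. The gap vector is $\gamma(\mathcal{P})_j:=Ehr_{\mathcal{P}}(j)-H_{\mathcal{P}}(j)$,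 $j\ge 1$. *)

theory Defs
  imports "HOL-Analysis.Analysis"
begin

inductive_set semigroup_gen :: "'a::ab_semigroup_add set \<Rightarrow> 'a set"
  for G :: "'a set"
where
  base: "x \<in> G \<Longrightarrow> x \<in> semigroup_gen G"
| add: "x \<in> semigroup_gen G \<Longrightarrow> y \<in> semigroup_gen G \<Longrightarrow> x + y \<in> semigroup_gen G"

text \<open>In the following, a lattice polytope is given by a set \<open>P\<close> in a real vector space
  together with the lattice \<open>L\<close>, the latter as a subset of the vector space.\<close>

definition cone_semigroup :: "'a::real_vector set \<Rightarrow> 'a set \<Rightarrow> (int \<times> 'a) set" where
  "cone_semigroup L P = {(k, x). x \<in> L \<and> (of_int k, x) \<in> cone hull ({1 :: real} \<times> P)}"

definition polytope_semigroup :: "'a::real_vector set \<Rightarrow> 'a set \<Rightarrow> (int \<times> 'a) set" where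
  "polytope_semigroup L P = semigroup_gen ({1} \<times> (L \<inter> P))"

definition ehr :: "'a::real_vector set \<Rightarrow> 'a set \<Rightarrow> nat \<Rightarrow> nat" where
  "ehr L P j = card {p \<in> cone_semigroup L P. fst p = int j}"

definition hilb :: "'a::real_vector set \<Rightarrow> 'a set \<Rightarrow> nat \<Rightarrow> nat" where
  "hilb L P j = card {p \<in> polytope_semigroup L P. fst p = int j}"

text \<open>The semigroup generated by the lattice points need not contain \<open>0\<close> here, so only the
  entries with \<open>j \<ge> 1\<close> are meaningful.\<close>

definition gap :: "'a::real_vector set \<Rightarrow> 'a set \<Rightarrow> nat \<Rightarrow> int" where
  "gap L P j = int (ehr L P j) - int (hilb L P j)"

definition latticeM :: "((real^4) \<times> real) set" where
  "latticeM = {(x, t). (\<forall>i. x $ i \<in> \<int>) \<and> t \<in> \<int>}"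

text \<open>The numeral type \<open>4\<close> has the elements \<open>1, 2, 3, 4\<close> (with \<open>4 = 0\<close>).\<close>

definition vertexV :: "4 \<Rightarrow> 4 \<Rightarrow> real^4" where
  "vertexV i j = (\<chi> k. if k = i \<or> k = j then 1 else 0)"

definition polytopeQ :: "nat \<Rightarrow> nat \<Rightarrow> ((real^4) \<times> real) set" where
  "polytopeQ a b = convex hull
    {(vertexV 1 2, 0), (vertexV 1 2, 1),
     (vertexV 2 3, 0), (vertexV 2 3, 1),
     (vertexV 1 3, 0), (vertexV 1 3, 1),
     (vertexV 4 1, 0), (vertexV 4 1, real b),
     (vertexV 4 2, real (b + 4 * a + 2)), (vertexV 4 2, real (2 * b + 4 * a + 2)),
     (vertexV 4 3, real (2 * b + 11 * a + 4)), (vertexV 4 3, real (3 * b + 11 * a + 4))}"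

end

theory Submission
  imports Defs
begin

text \<open>The projection of \<open>\<Q>\<close> to the first four coordinates is the octahedron whose vertices are the six
  vectors \<open>V(i,j)\<close>, and \<open>\<Q>\<close> has one vertical segment over each of them. Every lattice point of \<open>\<Q>\<close> lies on
  one of these segments (\<open>lattice_points_polytopeQ\<close>). Hence a point \<open>(k, x, t)\<close> of the cone semigroup
  is a lattice point for which there are nonnegative real weights on the six vertices that add up to
  \<open>k\<close>, combine the vertices to \<open>x\<close>, and combine the segments to an interval containing \<open>t\<close>
  (\<open>cone_hull_segment_hull\<close>). It lies in the semigroup generated in degree one exactly if such
  weights can be chosen to be natural numbers (\<open>semigroup_gen_segments\<close>).

  The octahedron has three pairs of antipodal vertices, and all three pairs have the sum
  \<open>(1,1,1,1)\<close>. For given \<open>(k, x)\<close> the differences \<open>d\<^sub>1, d\<^sub>2, d\<^sub>3\<close> of the weights of antipodal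
  vertices are therefore determined, and only the distribution of the remaining weight
  \<open>n = (k - |d\<^sub>1| - |d\<^sub>2| - |d\<^sub>3|) / 2\<close> as \<open>\<alpha> + \<beta> + \<gamma>\<close> among the pairs \<open>{12,34}\<close>, \<open>{13,24}\<close>, \<open>{23,14}\<close> is free
  (\<open>ex_weights_iff\<close>). The interval of the pair sums has length \<open>b + 1\<close> for each pair, starting at
  \<open>q = 2b + 11a + 4\<close>, at \<open>p = b + 4a + 2\<close> and at \<open>0\<close>. So, up to a translation, the reachable heights
  form the union of the intervals \<open>[p \<beta> + q \<alpha>, p \<beta> + q \<alpha> + W]\<close>, where all intervals have the same
  length \<open>W = n (b + 1) + w\<close> and \<open>w\<close> comes from the differences. With real weights this union
  is everything from \<open>0\<close> to \<open>q n + W\<close>.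

  With natural weights one passes from \<open>0\<close> to \<open>p n\<close> and on to \<open>q n\<close> in steps of size \<open>p\<close> and
  \<open>q - p = b + 7a + 2\<close>, so that nothing is missed if \<open>n = 0\<close>, or if the larger step \<open>q - p\<close> is at most \<open>W + 1\<close>
  (\<open>triangle_cover\<close>). As \<open>b > 7a\<close>, both can only fail if \<open>n = 1\<close> and \<open>w < 7a < b\<close>, and the latter forces all
  differences to be nonnegative, because a negative one contributes \<open>b\<close> to \<open>w\<close>. Then \<open>x\<close> is
  \<open>(1,1,1,1)\<close> plus a combination of \<open>V(1,2), V(1,3), V(2,3)\<close> with natural coefficients of sum
  \<open>i = k - 2\<close>. There are \<open>(i + 2) choose 2\<close> such \<open>x\<close>, and over each of them the heights that
  remain are those strictly between the three intervals \<open>[0, b + 1 + i]\<close>,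
  \<open>[p, p + b + 1 + i]\<close>, \<open>[q, q + b + 1 + i]\<close>: there are \<open>max (4a - i) 0\<close> of them in the first gap and
  \<open>max (7a - i) 0\<close> in the second one.\<close>

section \<open>Polytopes with vertical segments over given points\<close>

text \<open>Keeping the weights as an argument allows the cone (arbitrary real weights) and the generated
  semigroup (weights in \<open>\<nat>\<close>) to be described by the same relation.\<close>

definition weights ::
  "('e::finite \<Rightarrow> 'a::real_vector) \<Rightarrow> ('e \<Rightarrow> int) \<Rightarrow> ('e \<Rightarrow> int) \<Rightarrow> real \<Rightarrow> 'a \<Rightarrow> real \<Rightarrow> ('e \<Rightarrow> real) \<Rightarrow> bool"
where
  "weights v l u k x t c \<longleftrightarrow> (\<forall>e. 0 \<le> c e) \<and> k = (\<Sum>e\<in>UNIV. c e) \<and> x = (\<Sum>e\<in>UNIV. c e *\<^sub>R v e)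
    \<and> (\<Sum>e\<in>UNIV. c e * l e) \<le> t \<and> t \<le> (\<Sum>e\<in>UNIV. c e * u e)"

definition segment_hull ::
  "('e::finite \<Rightarrow> 'a::real_vector) \<Rightarrow> ('e \<Rightarrow> int) \<Rightarrow> ('e \<Rightarrow> int) \<Rightarrow> ('a \<times> real) set" where
  "segment_hull v l u = convex hull (\<Union>e. {(v e, real_of_int (l e)), (v e, real_of_int (u e))})"

lemma weights_add:
  assumes "weights v l u k x t c" "weights v l u k' x' t' c'"
  shows "weights v l u (k + k') (x + x') (t + t') (\<lambda>e. c e + c' e)"
  using assms unfolding weights_def
  by (auto simp: sum.distrib algebra_simps intro: add_mono)

lemma weights_scale:
  assumes "weights v l u k x t c" "0 \<le> r"
  shows "weights v l u (r * k) (r *\<^sub>R x) (r * t) (\<lambda>e. r * c e)"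
  using assms unfolding weights_def
  by (auto simp: sum_distrib_left[symmetric] scaleR_sum_right[symmetric] mult.assoc mult_left_mono
      simp flip: scaleR_scaleR)

lemma weights_vertex:
  fixes t :: real
  assumes "l e \<le> t" "t \<le> u e"
  shows "weights v l u 1 (v e) t (\<lambda>f. if f = e then 1 else 0)"
  using assms unfolding weights_def by (simp add: if_distrib[of "\<lambda>r. r * _"] if_distrib[of "\<lambda>r. r *\<^sub>R _"] cong: if_cong)

lemma sum_in_convex_cone:
  assumes "convex K" "cone K" "0 \<in> K" "finite I" "\<And>e. e \<in> I \<Longrightarrow> f e \<in> K"
  shows "sum f I \<in> K"
  using assms(4,5) by (induction I rule: finite_induct) (use assms(1-3) convex_cone[of K] in auto)

text \<open>The right-hand side defines a convex cone containing the end points of the segments. Conversely,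
  moving with the same ratio along all segments reaches every height between the two weighted sums.\<close>

lemma cone_hull_segment_hull:
  assumes lu: "\<And>e. l e \<le> u e"
  shows "(k, (x, t)) \<in> cone hull ({1} \<times> segment_hull v l u) \<longleftrightarrow> (\<exists>c. weights v l u k x t c)"
    (is "?lhs \<longleftrightarrow> ?rhs")
proof
  let ?K = "{(k, (x, t)). \<exists>c. weights v l u k x t c}"
  have K: "convex ?K \<and> cone ?K"
    unfolding convex_cone by (auto intro: weights_add weights_scale)
  have "(\<Union>e. {(v e, real_of_int (l e)), (v e, real_of_int (u e))}) \<subseteq> Pair 1 -` ?K"
    using lu by (auto intro!: exI weights_vertex)
  moreover have "convex (Pair (1::real) -` ?K)"
    using K unfolding convex_def by fastforce
  ultimately have "segment_hull v l u \<subseteq> Pair 1 -` ?K"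
    unfolding segment_hull_def by (rule hull_minimal)
  then have "cone hull ({1} \<times> segment_hull v l u) \<subseteq> ?K"
    using K by (intro hull_minimal) auto
  then show "?lhs \<Longrightarrow> ?rhs" by blast
next
  let ?H = "cone hull ({1::real} \<times> segment_hull v l u)"
  assume ?rhs
  then obtain c where c: "\<And>e. 0 \<le> c e" "k = (\<Sum>e\<in>UNIV. c e)" "x = (\<Sum>e\<in>UNIV. c e *\<^sub>R v e)"
    and t: "(\<Sum>e\<in>UNIV. c e * l e) \<le> t" "t \<le> (\<Sum>e\<in>UNIV. c e * u e)"
    unfolding weights_def by auto
  \<comment> \<open>the common ratio in which all segments are divided\<close>
  obtain r where r: "0 \<le> r" "r \<le> 1"
    "t = (1 - r) * (\<Sum>e\<in>UNIV. c e * l e) + r * (\<Sum>e\<in>UNIV. c e * u e)"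
    using t in_segment(1)[of t "\<Sum>e\<in>UNIV. c e * l e" "\<Sum>e\<in>UNIV. c e * u e"]
    by (auto simp: closed_segment_eq_real_ivl)
  let ?h = "\<lambda>e. (1 - r) * l e + r * u e"
  have conv: "convex (segment_hull v l u)" by (simp add: segment_hull_def)
  have "(v e, ?h e) \<in> segment_hull v l u" for e
  proof -
    have "(v e, real_of_int (l e)) \<in> segment_hull v l u" "(v e, real_of_int (u e)) \<in> segment_hull v l u"
      unfolding segment_hull_def by (auto intro!: hull_inc)
    from convexD_alt[OF conv this, of r] r(1,2) show ?thesis
      by (simp add: algebra_simps)
  qed
  then have "c e *\<^sub>R (1, (v e, ?h e)) \<in> ?H" for e
    using c(1) by (intro mem_cone_hull) auto
  moreover have "convex ?H" using conv by (intro convex_cone_hull convex_Times) auto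
  moreover have "0 \<in> ?H"
    using cone_hull_contains_0[of "{1::real} \<times> segment_hull v l u"] \<open>\<And>e. (v e, ?h e) \<in> _\<close> by blast
  ultimately have "(\<Sum>e\<in>UNIV. c e *\<^sub>R (1, (v e, ?h e))) \<in> ?H"
    by (intro sum_in_convex_cone cone_cone_hull) auto
  also have "(\<Sum>e\<in>UNIV. c e *\<^sub>R (1::real, (v e, ?h e))) = (k, (x, t))"
    unfolding c(2,3) r(3)
    by (simp add: prod_eq_iff fst_sum snd_sum sum_distrib_left algebra_simps sum.distrib sum_subtractf)
  finally show ?lhs .
qed

text \<open>A coordinate of a convex combination of \<open>0\<close>-\<open>1\<close>-vectors that is an integer is \<open>0\<close> or \<open>1\<close>, and then
  every vector occurring with positive weight has this same coordinate. So a lattice point only uses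
  the vector equal to it.\<close>

lemma weights_lattice_vertex:
  fixes v :: "'e::finite \<Rightarrow> real ^ 'n"
  assumes "inj v" and v01: "\<And>e i. v e $ i = 0 \<or> v e $ i = 1"
    and w: "weights v l u 1 x t c" and int: "\<And>i. x $ i \<in> \<int>"
  obtains e where "x = v e" "l e \<le> t" "t \<le> u e"
proof -
  from w have c: "\<And>e. 0 \<le> c e" "1 = (\<Sum>e\<in>UNIV. c e)" "x = (\<Sum>e\<in>UNIV. c e *\<^sub>R v e)"
    and t: "(\<Sum>e\<in>UNIV. c e * l e) \<le> t" "t \<le> (\<Sum>e\<in>UNIV. c e * u e)"
    unfolding weights_def by auto
  have eq: "v f = x" if "c f > 0" for f
  proof -
    have "v f $ i = x $ i" for i
    proof -
      have xi: "x $ i = (\<Sum>e\<in>UNIV. c e * v e $ i)" by (simp add: c(3))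
      have "0 \<le> c e * v e $ i" "c e * v e $ i \<le> c e" for e
        using c(1)[of e] v01[of e i] by auto
      then have "0 \<le> x $ i" "x $ i \<le> 1"
        unfolding xi c(2) by (auto intro: sum_nonneg sum_mono)
      with int[of i] have "x $ i = 0 \<or> x $ i = 1"
        by (auto elim!: Ints_cases)
      then show ?thesis
      proof
        assume "x $ i = 0"
        then have "c f * v f $ i = 0"
          unfolding xi using \<open>\<And>e. 0 \<le> c e * v e $ i\<close> by (subst (asm) sum_nonneg_eq_0_iff) auto
        then show ?thesis using that \<open>x $ i = 0\<close> by simp
      next
        assume "x $ i = 1"
        then have "(\<Sum>e\<in>UNIV. c e - c e * v e $ i) = 0"
          using xi c(2) by (simp add: sum_subtractf)
        then have "c f - c f * v f $ i = 0"
          using \<open>\<And>e. c e * v e $ i \<le> c e\<close> by (subst (asm) sum_nonneg_eq_0_iff) auto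
        then show ?thesis using that \<open>x $ i = 1\<close> by simp
      qed
    qed
    then show ?thesis by (simp add: vec_eq_iff)
  qed
  obtain e where e: "c e > 0"
    using c(1,2) by (metis less_eq_real_def sum.neutral zero_neq_one)
  have zero: "c f = 0" if "f \<noteq> e" for f
    using eq[of f] eq[OF e] that \<open>inj v\<close> c(1)[of f] by (force simp: inj_def)
  then have c': "c = (\<lambda>f. if f = e then c e else 0)" by auto
  have single: "(\<Sum>f\<in>UNIV. c f * g f) = c e * g e" for g :: "'e \<Rightarrow> real"
    by (subst c') (simp add: if_distrib[of "\<lambda>r. r * _"] cong: if_cong)
  from single[of "\<lambda>_. 1"] c(2) have "c e = 1" by simp
  with that[OF eq[OF e, symmetric]] t show ?thesis by (simp add: single)
qed

lemma sum_fun_upd: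
  fixes g :: "'b \<Rightarrow> 'e::finite \<Rightarrow> 'z::ab_group_add"
  shows "(\<Sum>f\<in>UNIV. g (c f) f) = g (c e) e - g n e + (\<Sum>f\<in>UNIV. g ((c(e := n)) f) f)"
proof -
  have "(\<Sum>f\<in>UNIV - {e}. g ((c(e := n)) f) f) = (\<Sum>f\<in>UNIV - {e}. g (c f) f)"
    by (intro sum.cong) auto
  then show ?thesis
    by (simp add: sum.remove[of UNIV e "\<lambda>f. g (c f) f"]
        sum.remove[of UNIV e "\<lambda>f. g ((c(e := n)) f) f"] del: fun_upd_apply) simp
qed

text \<open>The point of this lemma is that integral segments add up without holes: the integers
  in a sum of integral intervals are sums of integers from the intervals. The induction therefore
  splits off one generator at a time.\<close>

lemma semigroup_gen_segments:
  fixes v :: "'e::finite \<Rightarrow> 'a::real_vector" and k :: int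
  assumes lu: "\<And>e. l e \<le> u e"
  defines "G \<equiv> {(v e, real_of_int t) | e t. l e \<le> t \<and> t \<le> u e}"
  shows "(k, (x, t)) \<in> semigroup_gen ({1} \<times> G) \<longleftrightarrow>
    1 \<le> k \<and> t \<in> \<int> \<and> (\<exists>c :: 'e \<Rightarrow> nat. weights v l u k x t (\<lambda>e. real (c e)))" (is "?lhs \<longleftrightarrow> ?rhs")
proof
  have "1 \<le> fst p \<and> snd (snd p) \<in> \<int> \<and>
      (\<exists>c :: 'e \<Rightarrow> nat. weights v l u (fst p) (fst (snd p)) (snd (snd p)) (\<lambda>e. real (c e)))"
    if "p \<in> semigroup_gen ({1} \<times> G)" for p :: "int \<times> 'a \<times> real"
    using that
  proof induction
    case (base p)
    then obtain e t where "p = (1, (v e, real_of_int t))" "l e \<le> t" "t \<le> u e"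
      by (auto simp: G_def)
    moreover have "(\<lambda>f. real (if f = e then 1 else 0)) = (\<lambda>f. if f = e then 1 else 0)" by auto
    ultimately show ?case
      by (auto intro!: exI[of _ "\<lambda>f. if f = e then 1 else 0"] weights_vertex)
  next
    case (add p q)
    then obtain c d :: "'e \<Rightarrow> nat" where
      "weights v l u (fst p) (fst (snd p)) (snd (snd p)) (\<lambda>e. real (c e))"
      "weights v l u (fst q) (fst (snd q)) (snd (snd q)) (\<lambda>e. real (d e))" by auto
    from weights_add[OF this] add.IH show ?case
      by (auto intro!: exI[of _ "\<lambda>e. c e + d e"])
  qed
  from this[of "(k, (x, t))"] show "?lhs \<Longrightarrow> ?rhs" by simp
next
  have build: "(int (Suc m), ((\<Sum>e\<in>UNIV. real (c e) *\<^sub>R v e), real_of_int t)) \<in> semigroup_gen ({1} \<times> G)"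
    if "sum c UNIV = Suc m" "(\<Sum>e\<in>UNIV. int (c e) * l e) \<le> t" "t \<le> (\<Sum>e\<in>UNIV. int (c e) * u e)"
    for m and c :: "'e \<Rightarrow> nat" and t
    using that
  proof (induction m arbitrary: c t)
    case 0
    then obtain e where e: "c e = 1" "\<And>f. f \<noteq> e \<Longrightarrow> c f = 0"
      using sum_eq_1_iff[of UNIV c] by auto
    then have c: "c = (\<lambda>f. if f = e then 1 else 0)" by auto
    have "l e \<le> t" "t \<le> u e"
      using 0(2,3) unfolding c by (simp_all add: if_distrib[of "\<lambda>r. int r * _"] cong: if_cong)
    moreover have "(\<Sum>f\<in>UNIV. real (c f) *\<^sub>R v f) = v e"
      unfolding c by (simp add: if_distrib[of "\<lambda>r. real r *\<^sub>R _"] cong: if_cong)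
    ultimately show ?case
      by (auto simp: G_def intro!: semigroup_gen.base)
  next
    case (Suc m)
    then obtain e where e: "c e > 0"
      by (metis Zero_not_Suc not_gr_zero sum.neutral)
    define d where "d = c(e := c e - 1)"
    have split: "(\<Sum>f\<in>UNIV. int (c f) * h f) = h e + (\<Sum>f\<in>UNIV. int (d f) * h f)" for h
      using sum_fun_upd[of "\<lambda>n f. int n * h f" c e "c e - 1"] e
      by (simp add: d_def of_nat_diff algebra_simps)
    have splitv: "(\<Sum>f\<in>UNIV. real (c f) *\<^sub>R v f) = v e + (\<Sum>f\<in>UNIV. real (d f) *\<^sub>R v f)"
      using sum_fun_upd[of "\<lambda>n f. real n *\<^sub>R v f" c e "c e - 1"] e
      by (simp add: d_def of_nat_diff algebra_simps)
    have "int (sum d UNIV) = int (Suc m)"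
      using split[of "\<lambda>_. 1"] arg_cong[OF Suc.prems(1), of int] by simp
    then have sum_d: "sum d UNIV = Suc m" by linarith
    let ?U = "\<Sum>f\<in>UNIV. int (d f) * u f"
    have LU: "(\<Sum>f\<in>UNIV. int (d f) * l f) \<le> ?U" using lu by (intro sum_mono mult_left_mono) auto
    \<comment> \<open>the lowest height of the generator for which the other summands can still reach the remaining height\<close>
    define s where "s = max (l e) (t - ?U)"
    have "(int (Suc m), ((\<Sum>f\<in>UNIV. real (d f) *\<^sub>R v f), real_of_int (t - s)))
        \<in> semigroup_gen ({1} \<times> G)"
      using Suc.prems(2,3) LU unfolding split by (intro Suc.IH sum_d) (auto simp: s_def)
    moreover have "(1, (v e, real_of_int s)) \<in> semigroup_gen ({1} \<times> G)"
      using Suc.prems(3) lu[of e] unfolding split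
      by (intro semigroup_gen.base) (auto simp: G_def s_def)
    ultimately show ?case
      unfolding splitv by (drule_tac semigroup_gen.add) (auto simp: add.commute)
  qed
  assume ?rhs
  then obtain c :: "'e \<Rightarrow> nat" and s where c: "1 \<le> k" "t = real_of_int s"
    "weights v l u k x t (\<lambda>e. real (c e))"
    by (auto elim!: Ints_cases)
  have "real_of_int k = real_of_int (int (sum c UNIV))" using c(3) by (simp add: weights_def)
  then have k: "k = int (sum c UNIV)" by linarith
  then obtain m where m: "sum c UNIV = Suc m" using c(1) by (cases "sum c UNIV") auto
  have "real_of_int (\<Sum>e\<in>UNIV. int (c e) * l e) \<le> real_of_int s"
    "real_of_int s \<le> real_of_int (\<Sum>e\<in>UNIV. int (c e) * u e)"
    using c(2,3) by (simp_all add: weights_def)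
  then have "(\<Sum>e\<in>UNIV. int (c e) * l e) \<le> s" "s \<le> (\<Sum>e\<in>UNIV. int (c e) * u e)"
    by linarith+
  from build[OF m this] show ?lhs
    using c(2,3) k m by (simp add: weights_def)
qed

section \<open>The octahedron and its antipodal pairs\<close>

text \<open>Every \<open>corner\<close> names a vertex of the octahedron by its two coordinates equal to \<open>1\<close>.\<close>

datatype corner = C12 | C13 | C23 | C14 | C24 | C34

lemma UNIV_corner: "UNIV = {C12, C13, C23, C14, C24, C34}"
  using corner.exhaust by auto

instance corner :: finite
  by standard (simp add: UNIV_corner)

lemma sum_corner: "sum f UNIV = f C12 + f C13 + f C23 + f C14 + f C24 + f C34"
  for f :: "corner \<Rightarrow> 'z::comm_monoid_add"
  by (simp add: UNIV_corner add.assoc)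

lemma all_corner: "(\<forall>e. P e) \<longleftrightarrow> P C12 \<and> P C13 \<and> P C23 \<and> P C14 \<and> P C24 \<and> P C34"
  by (metis corner.exhaust)

primrec vert :: "corner \<Rightarrow> real^4" where
  "vert C12 = vertexV 1 2"
| "vert C13 = vertexV 1 3"
| "vert C23 = vertexV 2 3"
| "vert C14 = vertexV 4 1"
| "vert C24 = vertexV 4 2"
| "vert C34 = vertexV 4 3"

text \<open>Over the vertex of corner \<open>e\<close> the polytope \<open>\<Q>\<close> has a vertical segment from height \<open>low a b e\<close> to
  \<open>high a b e\<close>. The segment lengths are recorded separately because unit and long segments play
  different roles in the gap count.\<close>

primrec low :: "nat \<Rightarrow> nat \<Rightarrow> corner \<Rightarrow> int" where
  "low a b C12 = 0"
| "low a b C13 = 0"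
| "low a b C23 = 0"
| "low a b C14 = 0"
| "low a b C24 = int b + 4 * int a + 2"
| "low a b C34 = 2 * int b + 11 * int a + 4"

primrec len :: "nat \<Rightarrow> corner \<Rightarrow> int" where
  "len b C12 = 1"
| "len b C13 = 1"
| "len b C23 = 1"
| "len b C14 = int b"
| "len b C24 = int b"
| "len b C34 = int b"

abbreviation high :: "nat \<Rightarrow> nat \<Rightarrow> corner \<Rightarrow> int" where
  "high a b e \<equiv> low a b e + len b e"

lemma polytopeQ_eq_segment_hull: "polytopeQ a b = segment_hull vert (low a b) (high a b)"
  unfolding polytopeQ_def segment_hull_def UNIV_corner
  by (rule arg_cong[of _ _ "\<lambda>S. convex hull S"]) (auto simp: algebra_simps)

lemma low_le_high: "low a b e \<le> high a b e"
  by (cases e) auto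

lemma inj_vert: "inj vert"
proof (rule injI)
  fix e f assume "vert e = vert f"
  then show "e = f"
    by (cases e; cases f) (auto simp: vertexV_def vec_eq_iff forall_4)
qed

lemma vert_coordinate: "vert e $ i = 0 \<or> vert e $ i = 1"
  by (cases e) (auto simp: vertexV_def)

text \<open>This recovers a polytope from the cone over it, so that the description of the cone also
  describes the polytope.\<close>

lemma cone_hull_height_one: "(1, y) \<in> cone hull ({1::real} \<times> P) \<longleftrightarrow> y \<in> P"
  by (auto simp: cone_hull_expl)

lemma lattice_points_polytopeQ:
  "latticeM \<inter> polytopeQ a b = {(vert e, real_of_int t) | e t. low a b e \<le> t \<and> t \<le> high a b e}"
proof -
  have mem: "(x, t) \<in> polytopeQ a b \<longleftrightarrow> (\<exists>c. weights vert (low a b) (high a b) 1 x t c)" for x t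
    unfolding polytopeQ_eq_segment_hull
    by (subst cone_hull_height_one[symmetric]) (rule cone_hull_segment_hull[OF low_le_high])
  have "(vert e, real_of_int t) \<in> latticeM \<inter> polytopeQ a b"
    if "low a b e \<le> t" "t \<le> high a b e" for e t
  proof -
    have "vert e $ i \<in> \<int>" for i using vert_coordinate[of e i] by auto
    then show ?thesis
      using weights_vertex[where l = "low a b" and u = "high a b" and e = e and v = vert and t = "real_of_int t"] that
      by (force simp: latticeM_def mem)
  qed
  moreover have "\<exists>e s. x = vert e \<and> t = real_of_int s \<and> low a b e \<le> s \<and> s \<le> high a b e"
    if "(x, t) \<in> latticeM" "(x, t) \<in> polytopeQ a b" for x t
  proof -
    note xt = that
    have "t \<in> \<int>" using xt(1) by (auto simp: latticeM_def)
    then obtain s where s: "t = real_of_int s" by (rule Ints_cases)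
    obtain c where "weights vert (low a b) (high a b) 1 x t c" using xt(2) mem by blast
    then obtain e where "x = vert e" "low a b e \<le> t" "t \<le> high a b e"
      using xt(1) by (elim weights_lattice_vertex[OF inj_vert vert_coordinate]) (auto simp: latticeM_def)
    then show ?thesis unfolding s by (metis of_int_le_iff)
  qed
  ultimately show ?thesis by auto
qed

lemma cone_semigroup_polytopeQ:
  "(k, (x, t)) \<in> cone_semigroup latticeM (polytopeQ a b) \<longleftrightarrow>
    (x, t) \<in> latticeM \<and> (\<exists>c. weights vert (low a b) (high a b) k x t c)"
  unfolding cone_semigroup_def polytopeQ_eq_segment_hull
  by (simp add: cone_hull_segment_hull[OF low_le_high])

lemma polytope_semigroup_polytopeQ:
  "(k, (x, t)) \<in> polytope_semigroup latticeM (polytopeQ a b) \<longleftrightarrow>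
    1 \<le> k \<and> t \<in> \<int> \<and> (\<exists>c. range c \<subseteq> \<nat> \<and> weights vert (low a b) (high a b) k x t c)"
proof -
  have "(\<exists>c :: corner \<Rightarrow> nat. Q (\<lambda>e. real (c e))) \<longleftrightarrow> (\<exists>c. range c \<subseteq> \<nat> \<and> Q c)" for Q
  proof
    assume "\<exists>c. range c \<subseteq> \<nat> \<and> Q c"
    then obtain c where "range c \<subseteq> \<nat>" "Q c" by blast
    have "c e = real (nat \<lfloor>c e\<rfloor>)" for e
    proof -
      have "c e \<in> \<nat>" using \<open>range c \<subseteq> \<nat>\<close> by auto
      then show ?thesis by (auto elim!: Nats_cases)
    qed
      then have "c = (\<lambda>e. real (nat \<lfloor>c e\<rfloor>))" by blast
    with \<open>Q c\<close> show "\<exists>c :: corner \<Rightarrow> nat. Q (\<lambda>e. real (c e))" by metis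
  qed (metis image_subsetI of_nat_in_Nats)
  then show ?thesis
    unfolding polytope_semigroup_def lattice_points_polytopeQ
    by (subst semigroup_gen_segments[OF low_le_high]) simp
qed

text \<open>The vector equation becomes a system of linear equations in which the right-hand sides are the
  differences of the weights of antipodal vertices.\<close>

lemma weights_vert:
  fixes k t :: real and c :: "corner \<Rightarrow> real"
  shows "weights vert (low a b) (high a b) k x t c \<longleftrightarrow>
    (\<forall>e. 0 \<le> c e) \<and> k = c C12 + c C13 + c C23 + c C14 + c C24 + c C34
    \<and> x $ 1 + x $ 2 - k = c C12 - c C34 \<and> x $ 1 + x $ 3 - k = c C13 - c C24
    \<and> x $ 2 + x $ 3 - k = c C23 - c C14 \<and> x $ 1 + x $ 2 + x $ 3 + x $ 4 = 2 * k
    \<and> (let L = real_of_int (low a b C24) * c C24 + real_of_int (low a b C34) * c C34 in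
        L \<le> t \<and> t \<le> L + c C12 + c C13 + c C23 + real b * (c C14 + c C24 + c C34))"
  unfolding weights_def sum_corner Let_def vec_eq_iff forall_4
  by (simp add: vertexV_def) (auto simp: algebra_simps)

text \<open>The height \<open>t\<close> can be reached with differences \<open>d\<^sub>1, d\<^sub>2, d\<^sub>3\<close> of antipodal weights in degree \<open>k\<close> when the
  antipodal pairs \<open>{12,34}\<close>, \<open>{13,24}\<close>, \<open>{23,14}\<close> receive the weights \<open>\<alpha>, \<beta>, \<gamma>\<close> from \<open>S\<close> on top
  of these differences. Here \<open>max d 0\<close> and \<open>max (- d) 0\<close> are the positive and the negative part of a
  difference, which belong to the first and to the second vertex of the pair.\<close>

definition covered :: "real set \<Rightarrow> nat \<Rightarrow> nat \<Rightarrow> real \<Rightarrow> real \<Rightarrow> real \<Rightarrow> real \<Rightarrow> real \<Rightarrow> bool" where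
  "covered S a b d\<^sub>1 d\<^sub>2 d\<^sub>3 k t \<longleftrightarrow>
    (\<exists>\<alpha>\<in>S. \<exists>\<beta>\<in>S. \<exists>\<gamma>\<in>S. 0 \<le> \<alpha> \<and> 0 \<le> \<beta> \<and> 0 \<le> \<gamma> \<and> 2 * (\<alpha> + \<beta> + \<gamma>) + \<bar>d\<^sub>1\<bar> + \<bar>d\<^sub>2\<bar> + \<bar>d\<^sub>3\<bar> = k \<and>
      (let L = real_of_int (low a b C24) * (\<beta> + max (- d\<^sub>2) 0) + real_of_int (low a b C34) * (\<alpha> + max (- d\<^sub>1) 0) in
        L \<le> t \<and> t \<le> L + (\<alpha> + \<beta> + \<gamma>) * (real b + 1) + max d\<^sub>1 0 + max d\<^sub>2 0 + max d\<^sub>3 0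
          + real b * (max (- d\<^sub>1) 0 + max (- d\<^sub>2) 0 + max (- d\<^sub>3) 0)))"

text \<open>Nonnegative weights \<open>u, v\<close> of an antipodal pair with prescribed difference \<open>u - v\<close> are the positive and the
  negative part of the difference plus \<open>min u v\<close>. The lemma will be used with \<open>S = UNIV\<close> for the cone and with
  \<open>S = \<nat>\<close> for the generated semigroup, whence the closure conditions on \<open>S\<close>.\<close>

lemma ex_weights_iff:
  fixes S :: "real set" and d\<^sub>1 d\<^sub>2 d\<^sub>3 k t :: real
  assumes x: "x $ 1 + x $ 2 = k + d\<^sub>1" "x $ 1 + x $ 3 = k + d\<^sub>2" "x $ 2 + x $ 3 = k + d\<^sub>3"
      "x $ 1 + x $ 2 + x $ 3 + x $ 4 = 2 * k"
    and add: "\<And>r s. r \<in> S \<Longrightarrow> s \<in> S \<Longrightarrow> r + s \<in> S"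
    and d: "{max d\<^sub>1 0, max d\<^sub>2 0, max d\<^sub>3 0, max (- d\<^sub>1) 0, max (- d\<^sub>2) 0, max (- d\<^sub>3) 0} \<subseteq> S"
  shows "(\<exists>c. range c \<subseteq> S \<and> weights vert (low a b) (high a b) k x t c) \<longleftrightarrow>
    covered S a b d\<^sub>1 d\<^sub>2 d\<^sub>3 k t"
    (is "?lhs \<longleftrightarrow> ?rhs")
proof
  assume ?lhs
  then obtain c where S: "\<And>e. c e \<in> S" and c: "weights vert (low a b) (high a b) k x t c" by blast
  let ?\<alpha> = "min (c C12) (c C34)" and ?\<beta> = "min (c C13) (c C24)" and ?\<gamma> = "min (c C23) (c C14)"
  note c = c[unfolded weights_vert all_corner]
  have d_eq: "d\<^sub>1 = c C12 - c C34" "d\<^sub>2 = c C13 - c C24" "d\<^sub>3 = c C23 - c C14"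
    using c x by auto
  have pos: "c C12 = ?\<alpha> + max d\<^sub>1 0" "c C13 = ?\<beta> + max d\<^sub>2 0" "c C23 = ?\<gamma> + max d\<^sub>3 0"
    "c C34 = ?\<alpha> + max (- d\<^sub>1) 0" "c C24 = ?\<beta> + max (- d\<^sub>2) 0" "c C14 = ?\<gamma> + max (- d\<^sub>3) 0"
    using d_eq by linarith+
  show ?rhs
    unfolding covered_def
  proof (rule bexI[of _ ?\<alpha>], rule bexI[of _ ?\<beta>], rule bexI[of _ ?\<gamma>], intro conjI)
    show "?\<alpha> \<in> S" "?\<beta> \<in> S" "?\<gamma> \<in> S" using S by (auto simp: min_def)
    show "0 \<le> ?\<alpha>" "0 \<le> ?\<beta>" "0 \<le> ?\<gamma>" using c by auto
    show "2 * (?\<alpha> + ?\<beta> + ?\<gamma>) + \<bar>d\<^sub>1\<bar> + \<bar>d\<^sub>2\<bar> + \<bar>d\<^sub>3\<bar> = k"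
    proof -
      have "2 * min p q + \<bar>p - q\<bar> = p + q" for p q :: real by linarith
      note this[of "c C12" "c C34"] this[of "c C13" "c C24"] this[of "c C23" "c C14"]
      moreover have "k = c C12 + c C13 + c C23 + c C14 + c C24 + c C34" using c by blast
      moreover have "2 * (m + m' + m'') + e + e' + e'' = q"
        if "2 * m + e = (p::real)" "2 * m' + e' = p'" "2 * m'' + e'' = p''" "q = p + p' + p''"
        for m m' m'' e e' e'' p p' p'' q :: real using that by argo
      ultimately show ?thesis unfolding d_eq by (simp only: add_ac)
    qed
    show "let L = real_of_int (low a b C24) * (?\<beta> + max (- d\<^sub>2) 0) + real_of_int (low a b C34) * (?\<alpha> + max (- d\<^sub>1) 0) in
        L \<le> t \<and> t \<le> L + (?\<alpha> + ?\<beta> + ?\<gamma>) * (real b + 1) + max d\<^sub>1 0 + max d\<^sub>2 0 + max d\<^sub>3 0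
          + real b * (max (- d\<^sub>1) 0 + max (- d\<^sub>2) 0 + max (- d\<^sub>3) 0)"
    proof -
      have "(?\<alpha> + ?\<beta> + ?\<gamma>) * (real b + 1) + max d\<^sub>1 0 + max d\<^sub>2 0 + max d\<^sub>3 0
          + real b * (max (- d\<^sub>1) 0 + max (- d\<^sub>2) 0 + max (- d\<^sub>3) 0)
        = (?\<alpha> + max d\<^sub>1 0) + (?\<beta> + max d\<^sub>2 0) + (?\<gamma> + max d\<^sub>3 0)
          + real b * ((?\<gamma> + max (- d\<^sub>3) 0) + (?\<beta> + max (- d\<^sub>2) 0) + (?\<alpha> + max (- d\<^sub>1) 0))"
        by (simp add: algebra_simps)
      then show ?thesis
        using c unfolding Let_def pos[symmetric] by (simp only: add.assoc)
    qed
  qed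
next
  assume ?rhs
  then obtain \<alpha> \<beta> \<gamma> where S: "\<alpha> \<in> S" "\<beta> \<in> S" "\<gamma> \<in> S" and nonneg: "0 \<le> \<alpha>" "0 \<le> \<beta>" "0 \<le> \<gamma>"
    and k: "2 * (\<alpha> + \<beta> + \<gamma>) + \<bar>d\<^sub>1\<bar> + \<bar>d\<^sub>2\<bar> + \<bar>d\<^sub>3\<bar> = k"
    and t: "let L = real_of_int (low a b C24) * (\<beta> + max (- d\<^sub>2) 0) + real_of_int (low a b C34) * (\<alpha> + max (- d\<^sub>1) 0) in
        L \<le> t \<and> t \<le> L + (\<alpha> + \<beta> + \<gamma>) * (real b + 1) + max d\<^sub>1 0 + max d\<^sub>2 0 + max d\<^sub>3 0
          + real b * (max (- d\<^sub>1) 0 + max (- d\<^sub>2) 0 + max (- d\<^sub>3) 0)"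
    unfolding covered_def by blast
  let ?c = "case_corner (\<alpha> + max d\<^sub>1 0) (\<beta> + max d\<^sub>2 0) (\<gamma> + max d\<^sub>3 0)
    (\<gamma> + max (- d\<^sub>3) 0) (\<beta> + max (- d\<^sub>2) 0) (\<alpha> + max (- d\<^sub>1) 0)"
  have "?c e \<in> S" for e
    using S d by (cases e) (auto intro!: add)
  moreover have "weights vert (low a b) (high a b) k x t ?c"
    unfolding weights_vert all_corner corner.case
  proof (intro conjI)
    show "let L = real_of_int (low a b C24) * (\<beta> + max (- d\<^sub>2) 0) + real_of_int (low a b C34) * (\<alpha> + max (- d\<^sub>1) 0) in
        L \<le> t \<and> t \<le> L + (\<alpha> + max d\<^sub>1 0) + (\<beta> + max d\<^sub>2 0) + (\<gamma> + max d\<^sub>3 0)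
          + real b * ((\<gamma> + max (- d\<^sub>3) 0) + (\<beta> + max (- d\<^sub>2) 0) + (\<alpha> + max (- d\<^sub>1) 0))"
      using t unfolding Let_def by (simp only: algebra_simps mult_1 mult_1_right)
    have "\<bar>d\<bar> = max d 0 + max (- d) 0" for d :: real by linarith
    then show "k = \<alpha> + max d\<^sub>1 0 + (\<beta> + max d\<^sub>2 0) + (\<gamma> + max d\<^sub>3 0)
        + (\<gamma> + max (- d\<^sub>3) 0) + (\<beta> + max (- d\<^sub>2) 0) + (\<alpha> + max (- d\<^sub>1) 0)"
      unfolding k[symmetric] by (simp only: algebra_simps)
    show "x $ 1 + x $ 2 - k = \<alpha> + max d\<^sub>1 0 - (\<alpha> + max (- d\<^sub>1) 0)" using x(1) by linarith
    show "x $ 1 + x $ 3 - k = \<beta> + max d\<^sub>2 0 - (\<beta> + max (- d\<^sub>2) 0)" using x(2) by linarith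
    show "x $ 2 + x $ 3 - k = \<gamma> + max d\<^sub>3 0 - (\<gamma> + max (- d\<^sub>3) 0)" using x(3) by linarith
  qed (use nonneg x(4) in \<open>auto intro!: add_nonneg_nonneg\<close>)
  ultimately show ?lhs by blast
qed

section \<open>Covering an interval by translates\<close>

lemma chain_cover:
  fixes s :: "nat \<Rightarrow> int"
  assumes "\<And>m. m < N \<Longrightarrow> s (Suc m) \<le> s m + W + 1" and "s 0 \<le> t" "t \<le> s N + W"
  shows "\<exists>m\<le>N. s m \<le> t \<and> t \<le> s m + W"
  using assms
proof (induction N)
  case (Suc N)
  show ?case
  proof (cases "t \<le> s N + W")
    case True
    with Suc show ?thesis by (metis less_SucI le_SucI)
  next
    case False
    with Suc.prems(1)[of N] Suc.prems(3) show ?thesis by (intro exI[of _ "Suc N"]) auto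
  qed
qed auto

text \<open>The starting points \<open>p \<beta> + q \<alpha>\<close> with \<open>\<alpha> + \<beta> + \<gamma> = n\<close> contain the chain \<open>0, p, \<dots>, p n, p n + (q - p), \<dots>, q n\<close>, obtained
  by turning all \<open>\<gamma>\<close> units into \<open>\<beta>\<close> units and then all of these into \<open>\<alpha>\<close> units. If no step of this chain exceeds \<open>W + 1\<close>,
  the intervals of length \<open>W\<close> miss no integer.\<close>

lemma triangle_cover:
  fixes p q W t :: int and n :: nat
  assumes steps: "n > 0 \<Longrightarrow> p \<le> W + 1 \<and> q - p \<le> W + 1" and t: "0 \<le> t" "t \<le> q * int n + W"
  obtains \<alpha> \<beta> \<gamma> :: nat where "\<alpha> + \<beta> + \<gamma> = n"
    "p * int \<beta> + q * int \<alpha> \<le> t" "t \<le> p * int \<beta> + q * int \<alpha> + W"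
proof -
  define s where "s m = p * int (min m n) + (q - p) * int (m - n)" for m
  have "s (Suc m) \<le> s m + W + 1" if "m < 2 * n" for m
  proof (cases "m < n")
    case True
    then have "int (min (Suc m) n) = int m + 1" "int (min m n) = int m" "Suc m - n = 0" "m - n = 0" by auto
    then show ?thesis using steps that by (simp add: s_def algebra_simps)
  next
    case False
    then have "int (Suc m - n) = int (m - n) + 1" "min (Suc m) n = n" "min m n = n" by auto
    then show ?thesis using steps that by (simp add: s_def algebra_simps)
  qed
  moreover have "t \<le> s (2 * n) + W" using t(2) by (simp add: s_def algebra_simps)
  moreover have "s 0 \<le> t" using t(1) by (simp add: s_def)
  ultimately obtain m where m: "m \<le> 2 * n" "s m \<le> t" "t \<le> s m + W"
    using chain_cover[of "2 * n" s W t] by auto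
  let ?\<alpha> = "m - n" and ?\<beta> = "min m n - (m - n)" and ?\<gamma> = "n - min m n"
  have s: "s m = p * int ?\<beta> + q * int ?\<alpha>"
  proof -
    have "int ?\<beta> = int (min m n) - int ?\<alpha>" using m(1) by linarith
    then show ?thesis by (simp add: s_def algebra_simps)
  qed
  have "?\<alpha> + ?\<beta> + ?\<gamma> = n" using m(1) by linarith
  then show thesis using m(2,3) unfolding s by (rule that)
qed

text \<open>The integers strictly between the three intervals of length \<open>b + 1 + i\<close> that start at \<open>0\<close>, at
  \<open>b + 4a + 2\<close> and at \<open>2b + 11a + 4\<close>.\<close>

definition missing :: "nat \<Rightarrow> nat \<Rightarrow> int \<Rightarrow> int set" where
  "missing a b i = {int b + i + 2 .. int b + 4 * int a + 1}
    \<union> {2 * int b + 4 * int a + i + 4 .. 2 * int b + 11 * int a + 3}"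

lemma card_missing:
  assumes "0 \<le> i"
  shows "int (card (missing a b i)) = max (4 * int a - i) 0 + max (7 * int a - i) 0"
proof -
  have "card (missing a b i) = card {int b + i + 2 .. int b + 4 * int a + 1}
    + card {2 * int b + 4 * int a + i + 4 .. 2 * int b + 11 * int a + 3}"
    unfolding missing_def using assms by (intro card_Un_disjoint) auto
  then show ?thesis by simp
qed

text \<open>A height reachable with real but not with natural weights forces a step of
  length more than \<open>W + 1\<close> in \<open>triangle_cover\<close>. As \<open>b > 7a\<close>, this leaves only one unit of free weight and
  nonnegative differences.\<close>

lemma covered_real_not_nat:
  fixes a b :: nat and j d\<^sub>1 d\<^sub>2 d\<^sub>3 t :: int
  assumes ab: "b > 7 * a" and parity: "even (j + d\<^sub>1 + d\<^sub>2 + d\<^sub>3)"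
  assumes real: "covered UNIV a b d\<^sub>1 d\<^sub>2 d\<^sub>3 j t" and nat: "\<not> covered \<nat> a b d\<^sub>1 d\<^sub>2 d\<^sub>3 j t"
  shows "0 \<le> d\<^sub>1 \<and> 0 \<le> d\<^sub>2 \<and> 0 \<le> d\<^sub>3 \<and> d\<^sub>1 + d\<^sub>2 + d\<^sub>3 + 2 = j \<and> t \<in> missing a b (d\<^sub>1 + d\<^sub>2 + d\<^sub>3)"
proof -
  \<comment> \<open>\<open>p\<close>, \<open>q\<close> are the starting points for single pairs; \<open>\<rho>\<close> and \<open>w\<close> are the starting point and the length contributed by the differences\<close>
  define p q where "p = low a b C24" and "q = low a b C34"
  define m\<^sub>1 m\<^sub>2 m\<^sub>3 where "m\<^sub>1 = max (- d\<^sub>1) 0" and "m\<^sub>2 = max (- d\<^sub>2) 0" and "m\<^sub>3 = max (- d\<^sub>3) 0"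
  define w where "w = max d\<^sub>1 0 + max d\<^sub>2 0 + max d\<^sub>3 0 + int b * (m\<^sub>1 + m\<^sub>2 + m\<^sub>3)"
  define \<rho> where "\<rho> = p * m\<^sub>2 + q * m\<^sub>1"
  have pq: "0 \<le> p" "p \<le> q" by (auto simp: p_def q_def)
  have m0: "0 \<le> m\<^sub>1" "0 \<le> m\<^sub>2" "0 \<le> m\<^sub>3" by (auto simp: m\<^sub>1_def m\<^sub>2_def m\<^sub>3_def)
  have cov: "covered S a b d\<^sub>1 d\<^sub>2 d\<^sub>3 j t \<longleftrightarrow>
    (\<exists>\<alpha>\<in>S. \<exists>\<beta>\<in>S. \<exists>\<gamma>\<in>S. 0 \<le> \<alpha> \<and> 0 \<le> \<beta> \<and> 0 \<le> \<gamma>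
      \<and> 2 * (\<alpha> + \<beta> + \<gamma>) + real_of_int (\<bar>d\<^sub>1\<bar> + \<bar>d\<^sub>2\<bar> + \<bar>d\<^sub>3\<bar>) = j
      \<and> p * \<beta> + q * \<alpha> \<le> real_of_int (t - \<rho>)
      \<and> real_of_int (t - \<rho>) \<le> p * \<beta> + q * \<alpha> + (\<alpha> + \<beta> + \<gamma>) * (real b + 1) + real_of_int w)" for S
    unfolding covered_def Let_def p_def[symmetric] q_def[symmetric]
    by (simp add: \<rho>_def w_def m\<^sub>1_def m\<^sub>2_def m\<^sub>3_def of_int_max algebra_simps)
  obtain \<alpha> \<beta> \<gamma> :: real where nonneg: "0 \<le> \<alpha>" "0 \<le> \<beta>" "0 \<le> \<gamma>"
    and k: "2 * (\<alpha> + \<beta> + \<gamma>) + real_of_int (\<bar>d\<^sub>1\<bar> + \<bar>d\<^sub>2\<bar> + \<bar>d\<^sub>3\<bar>) = j"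
    and t: "p * \<beta> + q * \<alpha> \<le> real_of_int (t - \<rho>)"
      "real_of_int (t - \<rho>) \<le> p * \<beta> + q * \<alpha> + (\<alpha> + \<beta> + \<gamma>) * (real b + 1) + real_of_int w"
    using real unfolding cov by blast
  have "even (j - (\<bar>d\<^sub>1\<bar> + \<bar>d\<^sub>2\<bar> + \<bar>d\<^sub>3\<bar>))"
    using parity by auto
  then obtain n' where n': "j - (\<bar>d\<^sub>1\<bar> + \<bar>d\<^sub>2\<bar> + \<bar>d\<^sub>3\<bar>) = 2 * n'" by (rule evenE)
  have j: "j = 2 * n' + (\<bar>d\<^sub>1\<bar> + \<bar>d\<^sub>2\<bar> + \<bar>d\<^sub>3\<bar>)" using n' by linarith
  have sum: "\<alpha> + \<beta> + \<gamma> = real_of_int n'" using k unfolding j by simp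
  then have "0 \<le> n'" using nonneg by linarith
  then obtain n where n: "n' = int n" by (rule nonneg_int_cases)
  note j = j[unfolded n] and sum = sum[unfolded n]
  define W where "W = int n * (int b + 1) + w"
  have "0 \<le> real_of_int (t - \<rho>)"
    using t(1) pq nonneg by (smt (verit) mult_nonneg_nonneg of_int_0_le_iff)
  then have lower: "0 \<le> t - \<rho>" by linarith
  have "p * \<beta> + q * \<alpha> \<le> q * \<beta> + q * \<alpha> + q * \<gamma>"
    using pq nonneg by (smt (verit) mult_nonneg_nonneg mult_right_mono of_int_0_le_iff of_int_le_iff)
  also have "\<dots> = q * real n" unfolding sum[unfolded of_int_of_nat_eq, symmetric] by (simp add: algebra_simps)
  finally have "real_of_int (t - \<rho>) \<le> real_of_int (q * int n + W)"
    using t(2) unfolding sum by (simp add: W_def)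
  then have upper: "t - \<rho> \<le> q * int n + W" by linarith
  have uncovered: False if "\<alpha> + \<beta> + \<gamma> = n" "p * int \<beta> + q * int \<alpha> \<le> t - \<rho>"
      "t - \<rho> \<le> p * int \<beta> + q * int \<alpha> + W" for \<alpha> \<beta> \<gamma> :: nat
  proof -
    have "real_of_int (p * int \<beta> + q * int \<alpha>) \<le> real_of_int (t - \<rho>)"
      "real_of_int (t - \<rho>) \<le> real_of_int (p * int \<beta> + q * int \<alpha> + W)"
      using that(2,3) by (simp_all only: of_int_le_iff)
    moreover have sum': "real \<alpha> + real \<beta> + real \<gamma> = real n" using that(1) by auto
    ultimately have "covered \<nat> a b d\<^sub>1 d\<^sub>2 d\<^sub>3 j t"
      unfolding cov
      by (intro bexI[where x = "real \<alpha>"] bexI[where x = "real \<beta>"] bexI[where x = "real \<gamma>"])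
        (simp_all add: j W_def)
    then show False using nat by blast
  qed
  have "\<not> (n > 0 \<longrightarrow> p \<le> W + 1 \<and> q - p \<le> W + 1)"
    using triangle_cover[of n p W q "t - \<rho>"] lower upper uncovered by blast
  then have "n > 0" and small: "W < int b + 7 * int a + 1"
    by (auto simp: p_def q_def)
  have "w \<ge> 0" using m0 by (auto simp: w_def)
  have "n = 1"
  proof (rule ccontr)
    assume "n \<noteq> 1"
    with \<open>n > 0\<close> have "2 * (int b + 1) \<le> int n * (int b + 1)" by (intro mult_right_mono) auto
    then show False using small \<open>w \<ge> 0\<close> ab by (simp add: W_def)
  qed
  then have "w < 7 * int a" using small by (simp add: W_def)
  have "m\<^sub>1 + m\<^sub>2 + m\<^sub>3 = 0"
  proof (rule ccontr)
    assume "m\<^sub>1 + m\<^sub>2 + m\<^sub>3 \<noteq> 0"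
    then have "int b * 1 \<le> int b * (m\<^sub>1 + m\<^sub>2 + m\<^sub>3)" using m0 by (intro mult_left_mono) auto
    then have "int b \<le> w" by (simp add: w_def)
    then show False using \<open>w < 7 * int a\<close> ab by simp
  qed
  then have m: "m\<^sub>1 = 0" "m\<^sub>2 = 0" "m\<^sub>3 = 0" using m0 by auto
  then have d: "0 \<le> d\<^sub>1" "0 \<le> d\<^sub>2" "0 \<le> d\<^sub>3" by (auto simp: m\<^sub>1_def m\<^sub>2_def m\<^sub>3_def)
  have w: "w = d\<^sub>1 + d\<^sub>2 + d\<^sub>3" and \<rho>: "\<rho> = 0" using d m by (auto simp: w_def \<rho>_def)
  have "t \<in> missing a b (d\<^sub>1 + d\<^sub>2 + d\<^sub>3)"
  proof -
    have "\<not> (0 \<le> t \<and> t \<le> W)" "\<not> (p \<le> t \<and> t \<le> p + W)" "\<not> (q \<le> t \<and> t \<le> q + W)"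
      using uncovered[of 0 0 1] uncovered[of 0 1 0] uncovered[of 1 0 0] by (auto simp: \<open>n = 1\<close> \<rho>)
    then show ?thesis
      using lower upper unfolding \<open>n = 1\<close> W_def w \<rho> missing_def by (auto simp: p_def q_def)
  qed
  then show ?thesis using d j \<open>n = 1\<close> by auto
qed

text \<open>Real weights slide the unit of free weight continuously from the pair \<open>{23,14}\<close> to the pair \<open>{12,34}\<close>, which moves the
  lower end of the interval through every height from \<open>0\<close> to \<open>2b + 11a + 4\<close>.\<close>

lemma missing_covered_real:
  fixes a b :: nat and d\<^sub>1 d\<^sub>2 d\<^sub>3 t :: int
  assumes d: "0 \<le> d\<^sub>1" "0 \<le> d\<^sub>2" "0 \<le> d\<^sub>3" and t: "t \<in> missing a b (d\<^sub>1 + d\<^sub>2 + d\<^sub>3)"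
  shows "covered UNIV a b d\<^sub>1 d\<^sub>2 d\<^sub>3 (d\<^sub>1 + d\<^sub>2 + d\<^sub>3 + 2) t"
proof -
  let ?q = "low a b C34"
  let ?\<alpha> = "real_of_int t / real_of_int ?q"
  have tq: "0 \<le> t" "t \<le> ?q" "0 < ?q" using t d by (auto simp: missing_def)
  then have "0 \<le> ?\<alpha>" "?\<alpha> \<le> 1" "?q * ?\<alpha> = t" by (auto simp: divide_simps simp del: low.simps)
  then show ?thesis
    unfolding covered_def Let_def using d
    by (intro bexI[of _ ?\<alpha>] bexI[of _ 0] bexI[of _ "1 - ?\<alpha>"]) (auto simp del: low.simps)
qed

text \<open>The unit of free weight is indivisible now and goes to one of the three pairs.\<close>

lemma missing_not_covered_nat:
  fixes a b :: nat and d\<^sub>1 d\<^sub>2 d\<^sub>3 t :: int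
  assumes d: "0 \<le> d\<^sub>1" "0 \<le> d\<^sub>2" "0 \<le> d\<^sub>3" and t: "t \<in> missing a b (d\<^sub>1 + d\<^sub>2 + d\<^sub>3)"
  shows "\<not> covered \<nat> a b d\<^sub>1 d\<^sub>2 d\<^sub>3 (d\<^sub>1 + d\<^sub>2 + d\<^sub>3 + 2) t"
proof
  assume "covered \<nat> a b d\<^sub>1 d\<^sub>2 d\<^sub>3 (d\<^sub>1 + d\<^sub>2 + d\<^sub>3 + 2) t"
  then obtain x y z :: real where "x \<in> \<nat>" "y \<in> \<nat>" "z \<in> \<nat>"
    and sum: "2 * (x + y + z) = 2"
    and bounds: "low a b C24 * y + low a b C34 * x \<le> t"
      "t \<le> low a b C24 * y + low a b C34 * x + (x + y + z) * (real b + 1) + d\<^sub>1 + d\<^sub>2 + d\<^sub>3"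
    using d unfolding covered_def Let_def by (auto simp del: low.simps)
  moreover obtain \<alpha> \<beta> \<gamma> :: nat where "x = real \<alpha>" "y = real \<beta>" "z = real \<gamma>"
    using \<open>x \<in> \<nat>\<close> \<open>y \<in> \<nat>\<close> \<open>z \<in> \<nat>\<close> by (metis Nats_cases)
  moreover have "x + y + z = 1" using sum by simp
  ultimately have sum: "real \<alpha> + real \<beta> + real \<gamma> = 1"
    and bounds: "low a b C24 * real \<beta> + low a b C34 * real \<alpha> \<le> t"
      "t \<le> low a b C24 * real \<beta> + low a b C34 * real \<alpha> + (real b + 1) + d\<^sub>1 + d\<^sub>2 + d\<^sub>3"
    by (simp_all del: low.simps)
  from sum have "\<alpha> + \<beta> + \<gamma> = 1" by linarith
  then consider "\<alpha> = 1" "\<beta> = 0" | "\<alpha> = 0" "\<beta> = 1" | "\<alpha> = 0" "\<beta> = 0" by linarith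
  then show False
    using bounds t by cases (auto simp: missing_def)
qed

section \<open>Counting the gaps\<close>

lemma in_semigroups_iff_covered:
  fixes a b :: nat and k t :: int and X :: "4 \<Rightarrow> int"
  assumes x: "\<And>m. x $ m = real_of_int (X m)" and sum: "X 1 + X 2 + X 3 + X 4 = 2 * k"
  defines "d\<^sub>1 \<equiv> X 1 + X 2 - k" and "d\<^sub>2 \<equiv> X 1 + X 3 - k" and "d\<^sub>3 \<equiv> X 2 + X 3 - k"
  shows "(k, (x, real_of_int t)) \<in> cone_semigroup latticeM (polytopeQ a b) \<longleftrightarrow>
      covered UNIV a b d\<^sub>1 d\<^sub>2 d\<^sub>3 k t"
    and "1 \<le> k \<Longrightarrow> (k, (x, real_of_int t)) \<in> polytope_semigroup latticeM (polytopeQ a b) \<longleftrightarrow>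
      covered \<nat> a b d\<^sub>1 d\<^sub>2 d\<^sub>3 k t"
proof -
  have lattice: "(x, real_of_int t) \<in> latticeM" by (simp add: latticeM_def x)
  have "real_of_int (X 1 + X 2 + X 3 + X 4) = real_of_int (2 * k)" using sum by (rule arg_cong)
  then have eqs: "x $ 1 + x $ 2 = real_of_int k + d\<^sub>1" "x $ 1 + x $ 3 = real_of_int k + d\<^sub>2"
      "x $ 2 + x $ 3 = real_of_int k + d\<^sub>3" "x $ 1 + x $ 2 + x $ 3 + x $ 4 = 2 * real_of_int k"
    by (simp_all add: x d\<^sub>1_def d\<^sub>2_def d\<^sub>3_def)
  show "(k, (x, real_of_int t)) \<in> cone_semigroup latticeM (polytopeQ a b) \<longleftrightarrow>
      covered UNIV a b d\<^sub>1 d\<^sub>2 d\<^sub>3 k t"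
    unfolding cone_semigroup_polytopeQ using lattice ex_weights_iff[OF eqs, of UNIV a b t] by simp
  have nat: "max (real_of_int d) 0 \<in> \<nat>" for d
  proof -
    have "max (real_of_int d) 0 = real (nat d)" by (simp add: max_def)
    then show ?thesis by (simp only: of_nat_in_Nats)
  qed
  have nat': "max (- real_of_int d) 0 \<in> \<nat>" for d
    using nat[of "- d"] by (simp only: of_int_minus)
  have "covered \<nat> a b d\<^sub>1 d\<^sub>2 d\<^sub>3 k t \<longleftrightarrow>
      (\<exists>c. range c \<subseteq> \<nat> \<and> weights vert (low a b) (high a b) k x t c)"
    by (rule ex_weights_iff[OF eqs Nats_add, symmetric]) (simp_all only: nat nat' insert_subset empty_subsetI simp_thms)
  then show "(k, (x, real_of_int t)) \<in> polytope_semigroup latticeM (polytopeQ a b) \<longleftrightarrow>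
      covered \<nat> a b d\<^sub>1 d\<^sub>2 d\<^sub>3 k t" if "1 \<le> k"
    unfolding polytope_semigroup_polytopeQ using that by simp
qed

text \<open>The first two summands are an antipodal pair and add up to \<open>(1,1,1,1)\<close>. The last coefficient is computed in the reals, so that it
  is a natural number only for \<open>p + q \<le> i\<close>.\<close>

definition gap_vector :: "nat \<Rightarrow> nat \<Rightarrow> nat \<Rightarrow> real^4" where
  "gap_vector i p q = vert C12 + vert C34 + real p *\<^sub>R vert C12 + real q *\<^sub>R vert C13
    + (real i - real p - real q) *\<^sub>R vert C23"

lemma gap_vector_coordinates:
  "gap_vector i p q $ 1 = 1 + real p + real q" "gap_vector i p q $ 2 = 1 + real i - real q"
  "gap_vector i p q $ 3 = 1 + real i - real p" "gap_vector i p q $ 4 = 1"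
  by (simp_all add: gap_vector_def vertexV_def)

definition gap_point :: "nat \<Rightarrow> (nat \<times> nat) \<times> int \<Rightarrow> int \<times> ((real^4) \<times> real)" where
  "gap_point i = (\<lambda>((p, q), t). (int (i + 2), (gap_vector i p q, real_of_int t)))"

lemma inj_gap_point: "inj (gap_point i)"
  by (rule injI) (auto simp: gap_point_def vec_eq_iff forall_4 gap_vector_coordinates)

text \<open>The differences \<open>d\<^sub>1, d\<^sub>2, d\<^sub>3\<close> are the coordinates in which a gap is recognized: at a gap they are \<open>p\<close>, \<open>q\<close> and
  \<open>i - p - q\<close>.\<close>

lemma semigroup_difference:
  assumes "b > 7 * a"
  shows "{p \<in> cone_semigroup latticeM (polytopeQ a b). fst p = int (i + 2)}
    - {p \<in> polytope_semigroup latticeM (polytopeQ a b). fst p = int (i + 2)}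
    = gap_point i ` ({(p, q). p + q \<le> i} \<times> missing a b (int i))" (is "?E - ?H = ?G")
proof (intro subset_antisym subsetI)
  fix P assume P: "P \<in> ?E - ?H"
  let ?k = "int (i + 2)"
  obtain x s where "P = (?k, (x, s))" using P by (cases P) auto
  with P have E: "(?k, (x, s)) \<in> cone_semigroup latticeM (polytopeQ a b)"
    and H: "(?k, (x, s)) \<notin> polytope_semigroup latticeM (polytopeQ a b)" by auto
  from E obtain c where xs: "(x, s) \<in> latticeM" and c: "weights vert (low a b) (high a b) ?k x s c"
    unfolding cone_semigroup_polytopeQ by auto
  define X where "X m = \<lfloor>x $ m\<rfloor>" for m
  have x: "x $ m = real_of_int (X m)" for m
    using xs by (auto simp: latticeM_def X_def)
  have "s \<in> \<int>" using xs by (simp add: latticeM_def)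
  then obtain t where t: "s = real_of_int t" by (rule Ints_cases)
  have "x $ 1 + x $ 2 + x $ 3 + x $ 4 = 2 * real_of_int ?k"
    using c unfolding weights_vert by blast
  then have "real_of_int (X 1 + X 2 + X 3 + X 4) = real_of_int (2 * ?k)" by (simp add: x)
  then have sum: "X 1 + X 2 + X 3 + X 4 = 2 * ?k" by (rule of_int_eq_iff[THEN iffD1])
  let ?d = "\<lambda>m n. X m + X n - ?k"
  note cov = in_semigroups_iff_covered[OF x sum, of t a b]
  have "?k + ?d 1 2 + ?d 1 3 + ?d 2 3 = 2 * (X 1 + X 2 + X 3 - ?k)" by simp
  then have "even (?k + ?d 1 2 + ?d 1 3 + ?d 2 3)" by (rule ssubst) simp
  moreover have "covered UNIV a b (?d 1 2) (?d 1 3) (?d 2 3) ?k t"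
    using E unfolding t cov(1) .
  moreover have "1 \<le> ?k" by simp
  then have "\<not> covered \<nat> a b (?d 1 2) (?d 1 3) (?d 2 3) ?k t"
    using H unfolding t by (simp only: cov(2) not_False_eq_True)
  ultimately have d: "0 \<le> ?d 1 2" "0 \<le> ?d 1 3" "0 \<le> ?d 2 3" "?d 1 2 + ?d 1 3 + ?d 2 3 + 2 = ?k"
    and missing: "t \<in> missing a b (?d 1 2 + ?d 1 3 + ?d 2 3)"
    using covered_real_not_nat[OF assms] by blast+
  obtain p q where p: "?d 1 2 = int p" and q: "?d 1 3 = int q"
    using nonneg_int_cases[OF d(1)] nonneg_int_cases[OF d(2)] by metis
  have deg: "?d 1 2 + ?d 1 3 + ?d 2 3 = int i" using d(4) by linarith
  have "X 1 = 1 + int p + int q" "X 2 = 1 + int i - int q" "X 3 = 1 + int i - int p"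
    using p q deg by linarith+
  moreover from this have "X 4 = 1" using sum by simp
  ultimately have "x = gap_vector i p q"
    by (simp add: vec_eq_iff forall_4 gap_vector_coordinates x)
  then have "P = gap_point i ((p, q), t)"
    by (simp only: \<open>P = _\<close> gap_point_def t prod.case)
  moreover have "t \<in> missing a b (int i)" using missing unfolding deg .
  moreover have "p + q \<le> i" using d(3) p q deg by linarith
  ultimately show "P \<in> ?G" by auto
next
  fix P assume "P \<in> ?G"
  then obtain p q t where pq: "p + q \<le> i" and t: "t \<in> missing a b (int i)"
    and P: "P = gap_point i ((p, q), t)" by auto
  let ?x = "gap_vector i p q"
  define X where "X m = \<lfloor>?x $ m\<rfloor>" for m
  have X: "X 1 = 1 + int p + int q" "X 2 = 1 + int i - int q" "X 3 = 1 + int i - int p" "X 4 = 1"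
    unfolding X_def gap_vector_coordinates by linarith+
  have x: "?x $ m = real_of_int (X m)" for m
    using exhaust_4[of m] by (auto simp: X gap_vector_coordinates)
  have sum: "X 1 + X 2 + X 3 + X 4 = 2 * int (i + 2)" by (simp add: X)
  have d: "X 1 + X 2 - int (i + 2) = int p" "X 1 + X 3 - int (i + 2) = int q"
    "X 2 + X 3 - int (i + 2) = int i - int p - int q" by (simp_all add: X)
  have i: "int p + int q + (int i - int p - int q) = int i"
    "int p + int q + (int i - int p - int q) + 2 = int (i + 2)" by auto
  have "covered UNIV a b (int p) (int q) (int i - int p - int q) (int (i + 2)) t"
    "\<not> covered \<nat> a b (int p) (int q) (int i - int p - int q) (int (i + 2)) t"
    using missing_covered_real[of "int p" "int q" "int i - int p - int q" t a b]
      missing_not_covered_nat[of "int p" "int q" "int i - int p - int q" t a b] pq t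
    unfolding i by (auto simp: add.commute)
  note covered = this
  note iff = in_semigroups_iff_covered[OF x sum, of t a b, unfolded d]
  have "1 \<le> int (i + 2)" by simp
  then have "(int (i + 2), (gap_vector i p q, real_of_int t)) \<in> cone_semigroup latticeM (polytopeQ a b)"
    "(int (i + 2), (gap_vector i p q, real_of_int t)) \<notin> polytope_semigroup latticeM (polytopeQ a b)"
    using covered unfolding iff(1) by (simp_all only: iff(2) not_False_eq_True)
  then show "P \<in> ?E - ?H" unfolding P gap_point_def by simp
qed

lemma card_pairs_sum_le: "card {(p, q). p + q \<le> (i::nat)} = (i + 2) choose 2"
proof -
  have "{(p, q). p + q \<le> i} = (SIGMA p:{..i}. {..i - p})" by auto
  then have "card {(p, q). p + q \<le> i} = (\<Sum>p\<le>i. Suc (i - p))" by simp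
  also have "\<dots> = (\<Sum>p\<le>i. Suc p)"
    by (rule sum.reindex_bij_witness[of _ "\<lambda>p. i - p" "\<lambda>p. i - p"]) auto
  also have "\<dots> = (i + 2) choose 2"
    by (induction i) (simp_all add: numeral_2_eq_2)
  finally show ?thesis .
qed

lemma finite_degree_polytope_semigroup:
  "finite {p \<in> polytope_semigroup latticeM (polytopeQ a b). fst p = int j}"
proof (rule finite_subset)
  let ?point = "\<lambda>(c, t). (int j, ((\<Sum>e\<in>UNIV. real (c e) *\<^sub>R vert e), real_of_int t))"
  let ?C = "{c. \<forall>e. c e \<le> j} :: (corner \<Rightarrow> nat) set"
  let ?T = "{0 .. \<Sum>e\<in>UNIV. int j * high a b e}"
  have "?C = (UNIV :: corner set) \<rightarrow>\<^sub>E {..j}" by auto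
  then have "finite ?C" by (simp add: finite_PiE)
  then show "finite (?point ` (?C \<times> ?T))" by simp
  show "{p \<in> polytope_semigroup latticeM (polytopeQ a b). fst p = int j} \<subseteq> ?point ` (?C \<times> ?T)"
  proof clarsimp
    fix x s assume "(int j, (x, s)) \<in> polytope_semigroup latticeM (polytopeQ a b)"
    then obtain c where "s \<in> \<int>" and nat: "range c \<subseteq> \<nat>"
      and w: "weights vert (low a b) (high a b) (int j) x s c"
      unfolding polytope_semigroup_polytopeQ by blast
    obtain t where t: "s = real_of_int t" using \<open>s \<in> \<int>\<close> by (rule Ints_cases)
    have "\<forall>e. \<exists>n. c e = real n" using nat by (auto elim!: Nats_cases)
    then obtain n where c: "c = (\<lambda>e. real (n e))" by metis
    have "real (sum n UNIV) = real j" using w by (simp add: weights_def c)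
    then have "sum n UNIV = j" by linarith
    then have n: "n e \<le> j" for e by (auto intro: member_le_sum)
    have pos: "0 \<le> low a b e" "0 \<le> high a b e" for e by (cases e; simp)+
    have "real_of_int (\<Sum>e\<in>UNIV. int (n e) * low a b e) \<le> real_of_int t"
      "real_of_int t \<le> real_of_int (\<Sum>e\<in>UNIV. int (n e) * high a b e)"
      using w by (simp_all add: weights_def c t)
    then have "(\<Sum>e\<in>UNIV. int (n e) * low a b e) \<le> t" "t \<le> (\<Sum>e\<in>UNIV. int (n e) * high a b e)"
      by linarith+
    moreover have "0 \<le> (\<Sum>e\<in>UNIV. int (n e) * low a b e)" using pos by (intro sum_nonneg) auto
    moreover have "(\<Sum>e\<in>UNIV. int (n e) * high a b e) \<le> (\<Sum>e\<in>UNIV. int j * high a b e)"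
      using n pos by (intro sum_mono mult_right_mono) auto
    ultimately have "t \<in> ?T" by simp
    moreover have "x = (\<Sum>e\<in>UNIV. real (n e) *\<^sub>R vert e)" using w by (simp add: weights_def c)
    ultimately show "(int j, x, s) \<in> ?point ` (?C \<times> ?T)"
      using n t by (intro image_eqI[of _ _ "(n, t)"]) auto
  qed
qed

lemma polytope_semigroup_subset_cone_semigroup:
  "polytope_semigroup latticeM (polytopeQ a b) \<subseteq> cone_semigroup latticeM (polytopeQ a b)"
proof clarify
  fix k x t assume "(k, (x, t)) \<in> polytope_semigroup latticeM (polytopeQ a b)"
  then obtain c where t: "t \<in> \<int>" and nat: "range c \<subseteq> \<nat>" and w: "weights vert (low a b) (high a b) k x t c"
    unfolding polytope_semigroup_polytopeQ by blast
  have "c e * vert e $ m \<in> \<int>" for e m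
  proof -
    have "c e \<in> \<int>" using nat Nats_subset_Ints by auto
    then show ?thesis using vert_coordinate[of e m] by auto
  qed
  then have "x $ m \<in> \<int>" for m
    using w by (auto simp: weights_def)
  with t w show "(k, (x, t)) \<in> cone_semigroup latticeM (polytopeQ a b)"
    unfolding cone_semigroup_polytopeQ by (auto simp: latticeM_def)
qed

text \<open>The semigroup generated in degree one has finitely many elements of each degree, and so has its
  complement in the cone semigroup. Thus the gap is the cardinality of the difference.\<close>

theorem theorem16:
  fixes a b :: nat
  assumes "a > 0" and "b > 0" and "b > 7 * a"
  shows "\<forall>i::nat. gap latticeM (polytopeQ a b) (i + 2) =
    int ((i + 2) choose 2) * (max (4 * int a - int i) 0 + max (7 * int a - int i) 0)"
proof
  fix i :: nat
  let ?E = "{p \<in> cone_semigroup latticeM (polytopeQ a b). fst p = int (i + 2)}"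
  let ?H = "{p \<in> polytope_semigroup latticeM (polytopeQ a b). fst p = int (i + 2)}"
  let ?D = "{(p, q). p + q \<le> i} \<times> missing a b (int i)"
  have diff: "?E - ?H = gap_point i ` ?D" using assms(3) by (rule semigroup_difference)
  have "{(p, q). p + q \<le> i} \<subseteq> {..i} \<times> {..i}" by auto
  then have "finite {(p, q). p + q \<le> i}" by (rule finite_subset) simp
  then have "finite ?D" by (simp add: missing_def)
  have sub: "?H \<subseteq> ?E" using polytope_semigroup_subset_cone_semigroup by blast
  have finH: "finite ?H" by (rule finite_degree_polytope_semigroup)
  have "finite (?E - ?H)" unfolding diff using \<open>finite ?D\<close> by (rule finite_imageI)
  then have "finite ?E" using finite_Diff2[OF finH] by blast
  have "card ?D = card (?E - ?H)"
    unfolding diff by (rule card_image[OF inj_on_subset[OF inj_gap_point subset_UNIV], symmetric])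
  also have "\<dots> = card ?E - card ?H"
    by (rule card_Diff_subset[OF finH sub])
  finally have "gap latticeM (polytopeQ a b) (i + 2) = int (card ?D)"
    using card_mono[OF \<open>finite ?E\<close> sub] unfolding gap_def ehr_def hilb_def by linarith
  then show "gap latticeM (polytopeQ a b) (i + 2) =
      int ((i + 2) choose 2) * (max (4 * int a - int i) 0 + max (7 * int a - int i) 0)"
    by (simp only: card_cartesian_product card_pairs_sum_le of_nat_mult card_missing of_nat_0_le_iff)
qed

end
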